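(* Let $T$ be a tree of order $n\ge 3$ different from (not isomorphic to) the double star $S_{2,2}$. Then $\gamma_{rI}(T)\ge (n+3)/2$.
   Context: All graphs are finite and simple. For $f:V(G)\to\{0,1,2\}$, the weight is $\omega(f)=\sum_{v\in V(G)}f(v)$ and $V_i=\{v: f(v)=i\}$. An Italian dominating function of $G$ is a function $f:V(G)\to\{0,1,2\}$ such that every $v$ with $f(v)=0$ satisfies $\sum_{u\in N(v)}f(u)\ge 2$. A restrained Italian dominating (RID) function is an Italian dominating function for which the induced subgraph $G[V_0]$ has no isolated vertices; $\gamma_{rI}(G)$ is the minimum weight of an RID function of $G$. The double star $S_{p,q}$ is the tree with exactly two non-leaf vertices (which are adjacent), one adjacent to $p$ leaves and the other adjacent to $q$ leaves. *)

theory Defs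
  imports Complex_Main "HOL-Library.FuncSet" "Graph_Theory.Digraph_Isomorphism"
begin

text \<open>
  Finite simple graphs are the library's locale \<^locale>\<open>graph\<close>: finite, loop-free, symmetric
  digraphs without parallel arcs, each undirected edge being a pair of opposite arcs.
\<close>

definition nbhd :: "('a,'b) pre_digraph \<Rightarrow> 'a \<Rightarrow> 'a set" where
  "nbhd G v = {u. v \<rightarrow>\<^bsub>G\<^esub> u}"

text \<open>
  The constant \<^const>\<open>tree\<close> of the library is unsuitable: in a symmetric digraph the two arcs of an
  edge form a cycle of length 2, so it admits only the one-vertex graph. A cycle of the
  undirected graph is a cycle of length at least 3.
\<close>

definition undirected_tree :: "('a,'b) pre_digraph \<Rightarrow> bool" where
  "undirected_tree G \<longleftrightarrow>
     graph G \<and> connected G \<and> \<not> (\<exists>p. pre_digraph.cycle G p \<and> length p \<ge> 3)"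

definition leaf :: "('a,'b) pre_digraph \<Rightarrow> 'a \<Rightarrow> bool" where
  "leaf G v \<longleftrightarrow> v \<in> verts G \<and> card (nbhd G v) = 1"

text \<open>
  Functions are total on the vertex type; only their values on \<^term>\<open>verts G\<close> matter.
\<close>

definition weight :: "('a,'b) pre_digraph \<Rightarrow> ('a \<Rightarrow> nat) \<Rightarrow> nat" where
  "weight G f = (\<Sum>v\<in>verts G. f v)"

definition level_set :: "('a,'b) pre_digraph \<Rightarrow> ('a \<Rightarrow> nat) \<Rightarrow> nat \<Rightarrow> 'a set" where
  "level_set G f i = {v \<in> verts G. f v = i}"

definition italian_dominating :: "('a,'b) pre_digraph \<Rightarrow> ('a \<Rightarrow> nat) \<Rightarrow> bool" where
  "italian_dominating G f \<longleftrightarrow>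
     f \<in> verts G \<rightarrow> {0, 1, 2} \<and>
     (\<forall>v\<in>verts G. f v = 0 \<longrightarrow> (\<Sum>u\<in>nbhd G v. f u) \<ge> 2)"

definition isolated :: "('a,'b) pre_digraph \<Rightarrow> 'a \<Rightarrow> bool" where
  "isolated G v \<longleftrightarrow> v \<in> verts G \<and> nbhd G v = {}"

definition RID :: "('a,'b) pre_digraph \<Rightarrow> ('a \<Rightarrow> nat) \<Rightarrow> bool" where
  "RID G f \<longleftrightarrow>
     italian_dominating G f \<and> \<not> (\<exists>v. isolated (G \<restriction> level_set G f 0) v)"

text \<open>
  The infimum is a minimum: the constant function 1 is always an RID function.
\<close>

definition \<gamma>_rI :: "('a,'b) pre_digraph \<Rightarrow> nat" where
  "\<gamma>_rI G = Inf {weight G f | f. RID G f}"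

lemma RID_const_1: "RID G (\<lambda>_. 1)"
  by (auto simp: RID_def italian_dominating_def isolated_def level_set_def)

lemma \<gamma>_rI_attained: "\<exists>f. RID G f \<and> weight G f = \<gamma>_rI G"
proof -
  have "\<gamma>_rI G \<in> {weight G f | f. RID G f}"
    unfolding \<gamma>_rI_def by (rule Inf_nat_def1) (use RID_const_1 in blast)
  then show ?thesis by auto
qed

lemma \<gamma>_rI_le: "RID G f \<Longrightarrow> \<gamma>_rI G \<le> weight G f"
  unfolding \<gamma>_rI_def by (rule cInf_lower) auto

text \<open>
  The centres of the double star are \<open>(False, 0)\<close> and \<open>(True, 0)\<close>; their leaves are
  \<open>(False, 1), \<dots>, (False, p)\<close> and \<open>(True, 1), \<dots>, (True, q)\<close>. The lemmas below confirm, for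
  positive \<open>p\<close> and \<open>q\<close>, the usual description: a tree with exactly two non-leaf vertices,
  which are adjacent and have \<open>p\<close> and \<open>q\<close> leaf neighbours.
\<close>

definition double_star :: "nat \<Rightarrow> nat \<Rightarrow> (bool \<times> nat, (bool \<times> nat) \<times> (bool \<times> nat)) pre_digraph"
  where
  "double_star p q =
     (let E = {((False, 0), (True, 0))} \<union>
              {((False, 0), (False, i)) | i. 1 \<le> i \<and> i \<le> p} \<union>
              {((True, 0), (True, i)) | i. 1 \<le> i \<and> i \<le> q}
      in with_proj \<lparr> pverts = {False} \<times> {0..p} \<union> {True} \<times> {0..q}, parcs = E \<union> E\<inverse> \<rparr>)"

lemma verts_double_star: "verts (double_star p q) = {False} \<times> {0..p} \<union> {True} \<times> {0..q}"
  by (simp add: double_star_def Let_def)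

lemma nbhd_double_star:
  "nbhd (double_star p q) (False, 0) = insert (True, 0) ({False} \<times> {1..p})"
  "nbhd (double_star p q) (True, 0) = insert (False, 0) ({True} \<times> {1..q})"
  "1 \<le> i \<Longrightarrow> i \<le> p \<Longrightarrow> nbhd (double_star p q) (False, i) = {(False, 0)}"
  "1 \<le> i \<Longrightarrow> i \<le> q \<Longrightarrow> nbhd (double_star p q) (True, i) = {(True, 0)}"
  by (auto simp: nbhd_def double_star_def Let_def)

lemma leaf_double_star:
  assumes "p \<ge> 1" "q \<ge> 1"
  shows "{v. leaf (double_star p q) v} = {False} \<times> {1..p} \<union> {True} \<times> {1..q}"
proof -
  have c: "card (nbhd (double_star p q) (False, 0)) \<noteq> 1"
    "card (nbhd (double_star p q) (True, 0)) \<noteq> 1"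
    using assms by (auto simp: nbhd_double_star card_insert_if card_cartesian_product)
  have "leaf (double_star p q) (False, i) \<longleftrightarrow> 1 \<le> i \<and> i \<le> p" for i
  proof (cases "1 \<le> i \<and> i \<le> p")
    case True
    then show ?thesis by (simp add: leaf_def verts_double_star nbhd_double_star(3))
  next
    case False
    then have "i = 0 \<or> (False, i) \<notin> verts (double_star p q)"
      by (auto simp: verts_double_star)
    with False c(1) show ?thesis by (auto simp only: leaf_def)
  qed
  moreover have "leaf (double_star p q) (True, i) \<longleftrightarrow> 1 \<le> i \<and> i \<le> q" for i
  proof (cases "1 \<le> i \<and> i \<le> q")
    case True
    then show ?thesis by (simp add: leaf_def verts_double_star nbhd_double_star(4))
  next
    case False
    then have "i = 0 \<or> (True, i) \<notin> verts (double_star p q)"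
      by (auto simp: verts_double_star)
    with False c(2) show ?thesis by (auto simp only: leaf_def)
  qed
  ultimately have "leaf (double_star p q) (b, i) \<longleftrightarrow>
      (b, i) \<in> {False} \<times> {1..p} \<union> {True} \<times> {1..q}" for b i
    by (cases b) simp_all
  then show ?thesis by (simp add: set_eq_iff)
qed

lemma double_star_nonleaves:
  assumes "p \<ge> 1" "q \<ge> 1"
  shows "{v \<in> verts (double_star p q). \<not> leaf (double_star p q) v} = {(False, 0), (True, 0)}"
proof -
  have "{v \<in> verts (double_star p q). \<not> leaf (double_star p q) v} =
      verts (double_star p q) - {v. leaf (double_star p q) v}" by blast
  also have "\<dots> = {(False, 0), (True, 0)}"
    unfolding leaf_double_star[OF assms] verts_double_star by auto
  finally show ?thesis .
qed

lemma double_star_centres: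
  assumes "p \<ge> 1" "q \<ge> 1"
  shows "(True, 0) \<in> nbhd (double_star p q) (False, 0)"
    and "card {v \<in> nbhd (double_star p q) (False, 0). leaf (double_star p q) v} = p"
    and "card {v \<in> nbhd (double_star p q) (True, 0). leaf (double_star p q) v} = q"
proof -
  have "{v \<in> nbhd (double_star p q) (False, 0). leaf (double_star p q) v} = {False} \<times> {1..p}"
    "{v \<in> nbhd (double_star p q) (True, 0). leaf (double_star p q) v} = {True} \<times> {1..q}"
    unfolding Collect_conj_eq leaf_double_star[OF assms] by (auto simp: nbhd_double_star)
  then show "card {v \<in> nbhd (double_star p q) (False, 0). leaf (double_star p q) v} = p"
    "card {v \<in> nbhd (double_star p q) (True, 0). leaf (double_star p q) v} = q"
    by (simp_all add: card_cartesian_product)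
qed (simp add: nbhd_double_star)

lemma graph_double_star: "graph (double_star p q)"
proof -
  let ?G = "double_star p q"
  have fin: "finite (verts ?G)" by (simp add: verts_double_star)
  have sub: "arcs ?G \<subseteq> verts ?G \<times> verts ?G"
    by (auto simp: double_star_def Let_def)
  have fin': "finite (arcs ?G)"
    by (rule finite_subset[OF sub]) (simp add: fin)
  have ends: "tail ?G = fst" "head ?G = snd"
    by (simp_all add: double_star_def Let_def)
  have loop: "fst e \<noteq> snd e" if "e \<in> arcs ?G" for e
    using that by (auto simp: double_star_def Let_def)
  have "symmetric ?G"
    unfolding symmetric_def double_star_def Let_def with_proj_simps
    by (simp only: pair_pre_digraph.simps sym_Un_converse)
  moreover have "fst e \<in> verts ?G" "snd e \<in> verts ?G" if "e \<in> arcs ?G" for e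
    using subsetD[OF sub that] by (simp_all add: mem_Times_iff)
  ultimately show ?thesis
    using fin fin' loop
    by unfold_locales (simp_all add: ends arc_to_ends_def)
qed

lemma connected_double_star: "connected (double_star p q)"
proof -
  let ?G = "double_star p q"
  interpret graph ?G by (rule graph_double_star)
  have ft: "(False, 0) \<rightarrow>\<^bsub>?G\<^esub> (True, 0)" by (simp add: double_star_def Let_def)
  have from_c: "(False, 0) \<rightarrow>\<^sup>*\<^bsub>?G\<^esub> v" if "v \<in> verts ?G" for v
  proof -
    obtain b i where v: "v = (b, i)" by (cases v)
    have ctr: "(False, 0) \<rightarrow>\<^sup>*\<^bsub>?G\<^esub> (b, 0)"
      using ft by (cases b) (auto simp: verts_double_star)
    show ?thesis
    proof (cases "i = 0")
      case True
      with ctr v show ?thesis by simp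
    next
      case False
      with that v have "(b, 0) \<rightarrow>\<^bsub>?G\<^esub> (b, i)"
        by (cases b) (auto simp: double_star_def Let_def)
      with ctr v show ?thesis by (auto intro: reachable_adj_trans)
    qed
  qed
  have "strongly_connected ?G"
    unfolding strongly_connected_def
  proof (intro conjI ballI)
    show "verts ?G \<noteq> {}" by (auto simp: verts_double_star)
    fix u v assume "u \<in> verts ?G" "v \<in> verts ?G"
    then show "u \<rightarrow>\<^sup>*\<^bsub>?G\<^esub> v"
      by (rule reachable_trans[OF symmetric_reachable[OF sym_arcs from_c] from_c])
  qed
  then show ?thesis 
    by (simp add: connected_def strongly_connected_def reachable_mk_symmetric_eq[OF sym_arcs])
qed

lemma pcas_nth:
  assumes "pcas u c v" "i < length c"
  shows "fst (c ! i) = (if i = 0 then u else snd (c ! (i - 1)))"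
    and "i = length c - 1 \<Longrightarrow> snd (c ! i) = v"
  using assms
proof (induction c arbitrary: u i)
  case (Cons e es)
  {
    case 1
    then show ?case using Cons.IH(1)[where u = "snd e" and i = "i - 1"]
      by (cases i) (auto simp: nth_Cons split: nat.splits)
  next
    case 2
    then show ?case using Cons.IH(2)[where u = "snd e" and i = "i - 1"]
      by (cases i) (auto simp: nth_Cons split: nat.splits)
  }
qed auto

lemma tl_pawalk_verts: "tl (pawalk_verts u c) = map snd c" if "pcas u c v"
  using that
proof (induction c arbitrary: u)
  case (Cons e es)
  then show ?case by (cases es) auto
qed simp

lemma acyclic_double_star:
  assumes "pre_digraph.cycle (double_star p q) c"
  shows "length c < 3"
proof (rule ccontr)
  assume "\<not> length c < 3"
  then have k: "length c \<ge> 3" by simp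
  let ?k = "length c"
  obtain u where w: "set c \<subseteq> arcs (double_star p q)" and cas: "pcas u c u"
    and d: "distinct (map snd c)"
  proof -
    define D where "D = \<lparr>pverts = verts (double_star p q), parcs = arcs (double_star p q)\<rparr>"
    have D: "double_star p q = with_proj D"
      by (simp add: D_def double_star_def Let_def with_proj_def)
    obtain u where "set c \<subseteq> arcs (double_star p q)" "pcas u c u"
      "distinct (tl (pawalk_verts u c))"
      using assms unfolding D pre_digraph.cycle_def pre_digraph.awalk_def
        cas_with_proj_eq awalk_verts_with_proj_eq by blast
    with that show thesis by (simp add: tl_pawalk_verts)
  qed
  define pv where "pv i = (if i = 0 then ?k - 1 else i - 1)" for i
  define nx where "nx i = (if i = ?k - 1 then 0 else i + 1)" for i
  have link: "fst (c ! i) = snd (c ! pv i)" if "i < ?k" for i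
    using pcas_nth(1)[OF cas that] pcas_nth(2)[OF cas, of "?k - 1"] k by (auto simp: pv_def)
  have arc: "\<exists>b j. c ! i = ((b, 0), (b, j)) \<or> c ! i = ((b, j), (b, 0)) \<or>
      c ! i = ((b, 0), (\<not> b, 0))" if "i < ?k" for i
    using subsetD[OF w nth_mem[OF that]]
    by (auto simp: double_star_def Let_def) (metis (full_types))+
  have "snd (snd (c ! i)) = 0" if i: "i < ?k" for i
  proof (rule ccontr)
    assume nz: "snd (snd (c ! i)) \<noteq> 0"
    obtain b j where j: "c ! i = ((b, 0), (b, j))" "j \<noteq> 0" using arc[OF i] nz by auto
    have nk: "nx i < ?k" "pv i < ?k" "pv (nx i) = i" "pv i \<noteq> nx i"
      using i k by (auto simp: nx_def pv_def)
    then have "fst (c ! nx i) = (b, j)" using link[of "nx i"] j by simp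
    then have "snd (c ! nx i) = (b, 0)" using arc[OF nk(1)] j by auto
    moreover have "snd (c ! pv i) = (b, 0)" using link[OF i] j by simp
    ultimately show False
      using d nk nth_eq_iff_index_eq[OF d, of "pv i" "nx i"] by simp
  qed
  then have "snd x = 0" if "x \<in> set (map snd c)" for x
    using that unfolding in_set_conv_nth by (metis length_map nth_map)
  then have "set (map snd c) \<subseteq> UNIV \<times> {0}" by (simp add: subset_iff mem_Times_iff)
  then have "card (set (map snd c)) \<le> card ((UNIV :: bool set) \<times> {0 :: nat})"
    by (intro card_mono) auto
  then show False using distinct_card[OF d] k by (simp add: card_cartesian_product)
qed

lemma undirected_tree_double_star: "undirected_tree (double_star p q)"
  unfolding undirected_tree_def
  using graph_double_star connected_double_star acyclic_double_star leD by blast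

end

theory Submission
  imports Defs "Graph_Theory.Vertex_Walk"
begin

text \<open>
  In a forest every nonempty vertex set \<open>S\<close> spans at most \<open>|S| - 1\<close> edges. Let \<open>f\<close> be an RID
  function, put \<open>k = |V\<^sub>0|\<close>, \<open>n\<^sub>i = |V\<^sub>i|\<close>, and let \<open>m\<close> be twice the number of edges within \<open>V\<^sub>0\<close>, and \<open>b\<close>, \<open>a\<close> the
  numbers of edges from \<open>V\<^sub>0\<close> to \<open>V\<^sub>1\<close>, \<open>V\<^sub>2\<close>. Since \<open>V\<^sub>0\<close> induces no isolated vertex, \<open>m \<ge> k\<close>; domination
  gives \<open>b + 2 a \<ge> 2 k\<close>. Sparsity of the whole vertex set and of \<open>V\<^sub>0 \<union> V\<^sub>2\<close> gives
  \<open>m + 2 (a + b) + 2 \<le> 2 (k + n\<^sub>1 + n\<^sub>2)\<close> and \<open>m + 2 a + 2 \<le> 2 (k + n\<^sub>2)\<close>, the latter if \<open>n\<^sub>2 > 0\<close>.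
  Adding these up yields \<open>k + 3 \<le> n\<^sub>1 + 3 n\<^sub>2\<close>, which is the claim, unless \<open>n\<^sub>2 = 0\<close>, \<open>k = 2\<close> and
  \<open>n\<^sub>1 = 4\<close>; then all inequalities are tight and the tree is \<open>S\<^sub>2\<^sub>,\<^sub>2\<close>.
\<close>

section \<open>Vertex walks and the existence of cycles\<close>

text \<open>Longest-path arguments are easiest on vertex lists, but \<open>cycle\<close> speaks of
  arc walks; this lemma carries the former over to the latter.\<close>

lemma (in wf_digraph) vwalk_imp_awalk:
  assumes "vwalk p G"
  shows "\<exists>es. awalk (hd p) es (last p) \<and> awalk_verts (hd p) es = p"
  using assms
proof (induction p rule: vwalk_induct)
  case (Base u)
  then show ?case by (intro exI[of _ "[]"]) (simp add: awalk_Nil_iff)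
next
  case (Cons u v es)
  then obtain as where as: "awalk v as (last (v # es))" "awalk_verts v as = v # es" by auto
  from Cons.hyps obtain e where e: "e \<in> arcs G" "tail G e = u" "head G e = v"
    by (auto simp: arcs_ends_conv)
  with as show ?case by (intro exI[of _ "e # as"]) (simp add: awalk_Cons_iff)
qed

lemma (in wf_digraph) finite_nbhd: "finite (verts G) \<Longrightarrow> finite (nbhd G v)"
  by (rule finite_subset[of _ "verts G"]) (auto simp: nbhd_def)

lemma (in graph) ex_cycle_if_min_degree:
  assumes S: "S \<subseteq> verts G" "S \<noteq> {}"
    and deg: "\<And>v. v \<in> S \<Longrightarrow> 2 \<le> card (nbhd G v \<inter> S)"
  shows "\<exists>c. cycle c \<and> length c \<ge> 3"
proof -
  \<comment> \<open>All neighbours in \<open>S\<close> of the first vertex of a longest path in \<open>S\<close> lie on that path.\<close>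
  define P where "P xs \<longleftrightarrow> vwalk xs G \<and> distinct xs \<and> set xs \<subseteq> S" for xs
  have "finite S" using S(1) by (rule finite_subset) simp
  obtain s where "s \<in> S" using S by auto
  then have "P [s]" using S by (auto simp: P_def vwalk_def)
  moreover have "\<forall>xs. P xs \<longrightarrow> length xs < card S + 1"
    using \<open>finite S\<close> by (auto simp: P_def distinct_card[symmetric] less_Suc_eq_le intro: card_mono)
  ultimately obtain xs where xs: "P xs" and max: "\<And>ys. P ys \<Longrightarrow> length ys \<le> length xs"
    using ex_has_greatest_nat[of P "[s]" length "card S + 1"] by auto
  obtain x ys where x: "xs = x # ys" using xs by (cases xs) (auto simp: P_def)
  have "x \<in> S" using xs x by (auto simp: P_def)
  \<comment> \<open>For empty \<open>ys\<close> the value \<open>hd ys\<close> is unspecified, which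
    does no harm: two neighbours never fit into a singleton.\<close>
  have "\<not> nbhd G x \<inter> S \<subseteq> {hd ys}"
    using deg[OF \<open>x \<in> S\<close>] card_mono[of "{hd ys}" "nbhd G x \<inter> S"] by auto
  then obtain y where y: "x \<rightarrow> y" "y \<in> S" "y \<noteq> hd ys" by (auto simp: nbhd_def)
  have yx: "y \<rightarrow> x" using y sym_arcs arcs_ends_symmetric by metis
  have "x \<noteq> y" using y no_loops by (auto simp: arcs_ends_conv)
  have "y \<in> set xs"
  proof (rule ccontr)
    assume "y \<notin> set xs"
    then have "P (y # xs)"
      using xs y yx x unfolding P_def by (auto intro!: vwalk_wf_digraph_consI)
    from max[OF this] show False by simp
  qed
  then have "y \<in> set ys" using x \<open>x \<noteq> y\<close> by simp
  then obtain as bs where ys: "ys = as @ y # bs" by (meson split_list)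
  \<comment> \<open>Since \<open>y\<close> is not the immediate successor of \<open>x\<close>, the
    closed walk \<open>y # ?p\<close> is longer than an edge traversed back and forth.\<close>
  have "as \<noteq> []" using y ys by auto
  let ?p = "x # as @ [y]"
  have "vwalk ((x # as @ [y]) @ bs) G" using xs x ys by (simp add: P_def)
  then have "vwalk (x # as @ [y]) G" by (rule vwalkI_append_l[rotated]) simp
  then have "vwalk (y # ?p) G" by (rule vwalk_wf_digraph_consI) (use yx in simp)
  from vwalk_imp_awalk[OF this] obtain c where c: "awalk y c y" "awalk_verts y c = y # ?p"
    by auto
  have "length c + 1 = length (awalk_verts y c)" by (simp add: length_awalk_verts)
  then have "length c \<ge> 3" using c \<open>as \<noteq> []\<close> by (cases as) auto
  moreover have "cycle c"
    unfolding cycle_def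
    using c \<open>length c \<ge> 3\<close> xs x ys by (intro exI[of _ y]) (auto simp: P_def)
  ultimately show ?thesis by blast
qed

section \<open>Counting edges; sparsity of forests\<close>

lemma (in graph) finite_arcs_ends: "finite (arcs_ends G)"
  by (simp add: arcs_ends_conv)

lemma (in graph) card_arcs_ends_Times:
  assumes "finite X"
  shows "card (arcs_ends G \<inter> X \<times> Y) = (\<Sum>v\<in>X. card (nbhd G v \<inter> Y))"
proof -
  have "arcs_ends G \<inter> X \<times> Y = Sigma X (\<lambda>v. nbhd G v \<inter> Y)"
    by (auto simp: nbhd_def)
  then show ?thesis using assms by (simp add: card_SigmaI finite_nbhd)
qed

lemma (in graph) card_arcs_ends_commute:
  "card (arcs_ends G \<inter> X \<times> Y) = card (arcs_ends G \<inter> Y \<times> X)"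
proof -
  have "arcs_ends G \<inter> Y \<times> X = prod.swap ` (arcs_ends G \<inter> X \<times> Y)"
    using arcs_ends_symmetric[OF sym_arcs] by force
  then show ?thesis by (simp add: card_image)
qed

text \<open>As \<open>arcs_ends\<close> holds both orientations of every edge, this is the bound
  \<open>|S| - 1\<close> doubled and written without subtraction. By acyclicity some vertex of
  \<open>S\<close> has at most one neighbour in \<open>S\<close>; removing it destroys at most two
  ordered pairs, and induction applies.\<close>

lemma forest_sparse:
  assumes T: "undirected_tree T" and "S \<subseteq> verts T" "S \<noteq> {}"
  shows "card (arcs_ends T \<inter> S \<times> S) + 2 \<le> 2 * card S"
proof -
  interpret graph T using T by (simp add: undirected_tree_def)
  have "finite S" using assms(2) by (rule finite_subset) simp
  then show ?thesis using assms(2,3)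
  proof (induction S rule: finite_psubset_induct)
    case (psubset S)
    obtain v where v: "v \<in> S" "card (nbhd T v \<inter> S) < 2"
      using ex_cycle_if_min_degree[OF psubset.prems] T unfolding undirected_tree_def
      by (meson not_le)
    let ?S = "S - {v}" and ?R = "arcs_ends T"
    have irr: "(w, w) \<notin> ?R" for w using no_loops by (auto simp: arcs_ends_conv)
    have eq: "?R \<inter> S \<times> S = ?R \<inter> ?S \<times> ?S \<union> (?R \<inter> {v} \<times> S \<union> ?R \<inter> S \<times> {v})"
      using v by auto
    have "card (?R \<inter> S \<times> S) \<le>
        card (?R \<inter> ?S \<times> ?S) + (card (?R \<inter> {v} \<times> S) + card (?R \<inter> S \<times> {v}))"
      unfolding eq using card_Un_le[of "?R \<inter> ?S \<times> ?S" "?R \<inter> {v} \<times> S \<union> ?R \<inter> S \<times> {v}"]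
        card_Un_le[of "?R \<inter> {v} \<times> S" "?R \<inter> S \<times> {v}"] by linarith
    also have "\<dots> \<le> card (?R \<inter> ?S \<times> ?S) + 2"
      using v card_arcs_ends_commute[of S "{v}"] card_arcs_ends_Times[of "{v}" S] by simp
    finally have le: "card (?R \<inter> S \<times> S) \<le> card (?R \<inter> ?S \<times> ?S) + 2" .
    have cS: "card S = card ?S + 1" using card.remove[OF psubset.hyps v(1)] by simp
    show ?case
    proof (cases "?S = {}")
      case True
      then have "S = {v}" using v by auto
      then show ?thesis using irr by (auto simp: Int_insert_right)
    next
      case False
      have "?S \<subset> S" "?S \<subseteq> verts T" using v psubset.prems by auto
      from psubset.IH[OF this False] show ?thesis using le cS by linarith
    qed
  qed
qed

section \<open>Recognising the double star \<open>S_{2,2}\<close>\<close>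

text \<open>The arcs of \<open>G\<close> have an arbitrary type, those of \<open>H\<close> are
  pairs. Without parallel arcs an arc is determined by its ends, so mapping it to the pair of their
  images is injective.\<close>

lemma digraph_iso_projI:
  assumes "wf_digraph G" "nomulti_digraph G" "inj_on \<phi> (verts G)"
    and "tail H = fst" "head H = snd" "verts H = \<phi> ` verts G"
    and "arcs H = map_prod \<phi> \<phi> ` arcs_ends G"
  shows "digraph_iso G H"
proof -
  interpret nomulti_digraph G by fact
  let ?h = "\<lparr>iso_verts = \<phi>, iso_arcs = \<lambda>e. (\<phi> (tail G e), \<phi> (head G e)),
    iso_head = snd, iso_tail = fst\<rparr>"
  have "inj_on (\<lambda>e. (\<phi> (tail G e), \<phi> (head G e))) (arcs G)"
    using assms(3) no_multi_arcs by (auto simp: inj_on_def arc_to_ends_def)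
  then have "pre_digraph.digraph_isomorphism G ?h"
    using assms(1,3) by (simp add: pre_digraph.digraph_isomorphism_def)
  moreover have "H = app_iso ?h G"
    using assms(4-7) by (intro pre_digraph.equality) (auto simp: arcs_ends_conv)
  ultimately show ?thesis unfolding digraph_iso_def by blast
qed

lemma arcs_double_star_2_2:
  "arcs (double_star 2 2) =
    {((False, 0), (True, 0)), ((False, 0), (False, 1)), ((False, 0), (False, 2)),
     ((True, 0), (True, 1)), ((True, 0), (True, 2)),
     ((True, 0), (False, 0)), ((False, 1), (False, 0)), ((False, 2), (False, 0)),
     ((True, 1), (True, 0)), ((True, 2), (True, 0))}"
proof -
  have "1 \<le> i \<and> i \<le> 2 \<longleftrightarrow> i = 1 \<or> i = (2::nat)" for i by auto
  then show ?thesis by (auto simp: double_star_def Let_def)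
qed

text \<open>The five given edges yield ten ordered pairs, and sparsity allows no more than ten on
  six vertices, so there are no further edges.\<close>

lemma digraph_iso_double_star_2_2:
  assumes T: "undirected_tree T"
    and verts: "verts T = {u, v, a, b, c, d}" and dist: "distinct [u, v, a, b, c, d]"
    and edges: "(u, v) \<in> arcs_ends T" "(u, a) \<in> arcs_ends T" "(u, b) \<in> arcs_ends T"
      "(v, c) \<in> arcs_ends T" "(v, d) \<in> arcs_ends T"
  shows "digraph_iso T (double_star 2 2)"
proof -
  interpret graph T using T by (simp add: undirected_tree_def)
  let ?E = "[(u, v), (u, a), (u, b), (v, c), (v, d), (v, u), (a, u), (b, u), (c, v), (d, v)]"
  have "card (arcs_ends T \<inter> verts T \<times> verts T) + 2 \<le> 2 * card (verts T)"
    using T by (rule forest_sparse) (auto simp: verts)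
  moreover have "arcs_ends T \<inter> verts T \<times> verts T = arcs_ends T"
    by auto
  moreover have "card (verts T) = 6" using dist by (simp add: verts)
  ultimately have le: "card (arcs_ends T) \<le> 10" by simp
  have sub: "set ?E \<subseteq> arcs_ends T"
    using edges arcs_ends_symmetric[OF sym_arcs] by simp
  have "distinct ?E" using dist by auto
  then have "card (set ?E) = 10" using distinct_card[of ?E] by simp
  then have E: "arcs_ends T = set ?E"
    using card_seteq[OF finite_arcs_ends sub] le by simp
  define \<phi> where "\<phi> = (\<lambda>x. if x = u then (False, 0) else if x = v then (True, 0)
    else if x = a then (False, 1) else if x = b then (False, 2)
    else if x = c then (True, 1) else (True, 2 :: nat))"
  have \<phi>: "\<phi> u = (False, 0)" "\<phi> v = (True, 0)" "\<phi> a = (False, 1)" "\<phi> b = (False, 2)"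
    "\<phi> c = (True, 1)" "\<phi> d = (True, 2)" using dist by (auto simp: \<phi>_def)
  show ?thesis
  proof (rule digraph_iso_projI)
    show "inj_on \<phi> (verts T)" by (auto simp: verts inj_on_def \<phi>)
    have "{0..2} = {0, 1, 2::nat}" by auto
    then show "verts (double_star 2 2) = \<phi> ` verts T"
      unfolding verts verts_double_star by (simp add: \<phi>) blast
    show "arcs (double_star 2 2) = map_prod \<phi> \<phi> ` arcs_ends T"
      by (simp add: arcs_double_star_2_2 E \<phi>)
  qed (simp_all add: wf_digraph nomulti_digraph double_star_def Let_def)
qed

section \<open>The bound for RID functions on trees\<close>

lemma RID_in_level_set_0:
  assumes "RID G f" "v \<in> level_set G f 0" "graph G"
  shows "nbhd G v \<inter> level_set G f 0 \<noteq> {}"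
proof -
  interpret graph G by fact
  have "\<not> isolated (G \<restriction> level_set G f 0) v" using assms by (simp add: RID_def)
  then obtain w where "v \<rightarrow>\<^bsub>G \<restriction> level_set G f 0\<^esub> w"
    using assms(2) by (auto simp: isolated_def nbhd_def)
  then have "w \<in> nbhd G v \<inter> level_set G f 0"
    by (auto simp: nbhd_def arcs_ends_conv)
  then show ?thesis by blast
qed

theorem theorem3p1:
  fixes T :: "('a,'b) pre_digraph"
  assumes "undirected_tree T"
    and "card (verts T) \<ge> 3"
    and "\<not> digraph_iso T (double_star 2 2)"
  shows "real (\<gamma>_rI T) \<ge> (real (card (verts T)) + 3) / 2"
proof -
  note T = assms(1)
  interpret graph T using T by (simp add: undirected_tree_def)
  obtain f where f: "RID T f" and w: "weight T f = \<gamma>_rI T" using \<gamma>_rI_attained by blast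
  define V where "V = level_set T f"
  have fin: "finite (V i)" for i by (simp add: V_def level_set_def)
  have dis: "V i \<inter> V j = {}" if "i \<noteq> j" for i j using that by (auto simp: V_def level_set_def)
  have f012: "f v \<in> {0, 1, 2}" if "v \<in> verts T" for v
    using f that unfolding RID_def italian_dominating_def by blast
  have Vv: "V i \<subseteq> verts T" for i by (auto simp: V_def level_set_def)
  have fV: "f v = i" if "v \<in> V i" for v i using that by (simp add: V_def level_set_def)
  have sum_f: "sum f A = i * card A" if "A \<subseteq> V i" for A i
  proof -
    have "sum f A = (\<Sum>v\<in>A. i)" by (rule sum.cong) (use that fV in blast)+
    then show ?thesis by simp
  qed
  have verts: "verts T = V 0 \<union> V 1 \<union> V 2" using f012 by (auto simp: V_def level_set_def)
  \<comment> \<open>Ordered pairs are counted: \<open>e X X\<close> is twice the number of edges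
    inside \<open>X\<close>, whereas for disjoint sets \<open>e X Y\<close> counts each edge between
    them once.\<close>
  define e where "e X Y = card (arcs_ends T \<inter> X \<times> Y)" for X Y
  have e_split: "e (X \<union> Y) (X \<union> Y) = e X X + 2 * e X Y + e Y Y" if "X \<inter> Y = {}" for X Y
  proof -
    have "e (X \<union> Y) (X \<union> Y) = card ((arcs_ends T \<inter> X \<times> X \<union> arcs_ends T \<inter> X \<times> Y) \<union>
        (arcs_ends T \<inter> Y \<times> X \<union> arcs_ends T \<inter> Y \<times> Y))"
      unfolding e_def by (rule arg_cong[where f = card]) auto
    also have "\<dots> = (e X X + e X Y) + (e Y X + e Y Y)"
      unfolding e_def using that
      by (subst card_Un_disjoint; (auto simp: finite_arcs_ends)?)+
    finally show ?thesis using card_arcs_ends_commute[of X Y] by (simp add: e_def)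
  qed
  have e_split2: "e X (Y \<union> Z) = e X Y + e X Z" if "Y \<inter> Z = {}" for X Y Z
    unfolding e_def using that
    by (subst card_Un_disjoint[symmetric]) (auto simp: finite_arcs_ends intro: arg_cong[where f = card])
  define k n1 n2 where "k = card (V 0)" and "n1 = card (V 1)" and "n2 = card (V 2)"
  have n: "card (verts T) = k + n1 + n2"
    unfolding verts k_def n1_def n2_def using dis fin by (simp add: card_Un_disjoint Int_Un_distrib2)
  have "weight T f = (\<Sum>v\<in>V 0. f v) + (\<Sum>v\<in>V 1. f v) + (\<Sum>v\<in>V 2. f v)"
    unfolding weight_def verts using dis fin by (simp add: sum.union_disjoint Int_Un_distrib2)
  then have weight: "weight T f = n1 + 2 * n2"
    using sum_f[of "V 0" 0] sum_f[of "V 1" 1] sum_f[of "V 2" 2]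
    by (simp add: n1_def n2_def)
  have sum_Un3: "sum f (A \<union> B \<union> C) = sum f A + sum f B + sum f C"
    if "A \<subseteq> V 0" "B \<subseteq> V 1" "C \<subseteq> V 2" for A B C
  proof -
    have "finite A" "finite B" "finite C" using that fin finite_subset by metis+
    moreover have "A \<inter> B = {}" "(A \<union> B) \<inter> C = {}"
      using that dis[of 0 1] dis[of 0 2] dis[of 1 2] by auto
    ultimately show ?thesis by (simp add: sum.union_disjoint)
  qed
  have nbr0: "nbhd T v \<inter> V 0 \<noteq> {}" if "v \<in> V 0" for v
    using RID_in_level_set_0[OF f, of v] that graph_axioms by (simp add: V_def)
  have deg0: "card (nbhd T v \<inter> V 0) \<ge> 1" if "v \<in> V 0" for v
    using nbr0[OF that] fin by (simp add: Suc_le_eq card_gt_0_iff)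
  have dom: "card (nbhd T v \<inter> V 1) + 2 * card (nbhd T v \<inter> V 2) \<ge> 2" if "v \<in> V 0" for v
  proof -
    have N: "nbhd T v = nbhd T v \<inter> V 0 \<union> nbhd T v \<inter> V 1 \<union> nbhd T v \<inter> V 2"
      using verts adj_in_verts(2) unfolding nbhd_def by blast
    have "2 \<le> (\<Sum>u\<in>nbhd T v. f u)"
      using f that Vv fV[OF that] by (auto simp: RID_def italian_dominating_def)
    also have "\<dots> = (\<Sum>u\<in>nbhd T v \<inter> V 0. f u) + (\<Sum>u\<in>nbhd T v \<inter> V 1. f u)
        + (\<Sum>u\<in>nbhd T v \<inter> V 2. f u)"
      by (subst (1) N) (intro sum_Un3; simp)
    also have "\<dots> = card (nbhd T v \<inter> V 1) + 2 * card (nbhd T v \<inter> V 2)"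
      by (simp add: sum_f[of _ 0] sum_f[of _ 1] sum_f[of _ 2])
    finally show ?thesis .
  qed
  define m b a where "m = e (V 0) (V 0)" and "b = e (V 0) (V 1)" and "a = e (V 0) (V 2)"
  have m_ge: "k \<le> m"
    using sum_mono[of "V 0" "\<lambda>_. 1" "\<lambda>v. card (nbhd T v \<inter> V 0)"] deg0 fin
    by (simp add: m_def a_def b_def e_def card_arcs_ends_Times k_def)
  have ab: "2 * k \<le> b + 2 * a"
    using sum_mono[of "V 0" "\<lambda>_. 2" "\<lambda>v. card (nbhd T v \<inter> V 1) + 2 * card (nbhd T v \<inter> V 2)"]
      dom fin
    by (simp add: m_def a_def b_def e_def card_arcs_ends_Times k_def sum.distrib sum_distrib_left)
  have "e (verts T) (verts T) + 2 \<le> 2 * (k + n1 + n2)"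
    unfolding e_def n[symmetric] using assms(2) by (intro forest_sparse[OF T]) auto
  \<comment> \<open>Edges inside \<open>V 1 \<union> V 2\<close> are discarded.\<close>
  moreover have "e (verts T) (verts T) \<ge> m + 2 * (b + a)"
  proof -
    have "verts T = V 0 \<union> (V 1 \<union> V 2)" using verts by auto
    then show ?thesis using e_split[of "V 0" "V 1 \<union> V 2"] dis e_split2[of "V 1" "V 2"]
      by (simp add: Int_Un_distrib m_def a_def b_def)
  qed
  ultimately have all: "m + 2 * (b + a) + 2 \<le> 2 * (k + n1 + n2)"
    by (rule le_trans[OF add_right_mono, rotated])
  \<comment> \<open>Sparsity requires a nonempty set, which \<open>n2 > 0\<close> provides; edges
    inside \<open>V 2\<close> are discarded.\<close>
  have e02: "m + 2 * a + 2 \<le> 2 * (k + n2)" if "n2 > 0"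
  proof -
    have "card (V 0 \<union> V 2) = k + n2" using dis fin by (simp add: card_Un_disjoint k_def n2_def)
    moreover have "V 2 \<noteq> {}" using that by (auto simp: n2_def)
    ultimately have "e (V 0 \<union> V 2) (V 0 \<union> V 2) + 2 \<le> 2 * (k + n2)"
      unfolding e_def using Vv forest_sparse[OF T, of "V 0 \<union> V 2"] by auto
    then show ?thesis using e_split[of "V 0" "V 2"] dis by (simp add: m_def a_def)
  qed
  \<comment> \<open>This is the claim \<open>n + 3 \<le> 2 * weight\<close> after inserting
    \<open>n = k + n1 + n2\<close> and \<open>weight = n1 + 2 * n2\<close>.\<close>
  have "k + 3 \<le> n1 + 3 * n2"
  proof (cases "n2 = 0")
    case False
    then have "m + 2 * a + 2 \<le> 2 * (k + n2)" by (intro e02) simp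
    \<comment> \<open>Half the sum of \<open>all\<close> and \<open>e02\<close>, combined with
      \<open>ab\<close> and \<open>m_ge\<close>, gives \<open>k + 2 \<le> n1 + 2 * n2\<close>; the
      missing 1 comes from \<open>n2 \<ge> 1\<close>.\<close>
    then show ?thesis using False all ab m_ge by simp
  next
    case True
    then have V2: "V 2 = {}" using fin by (simp add: n2_def)
    then have e0: "a = 0" by (simp add: a_def e_def)
    show ?thesis
    proof (rule ccontr)
      assume small: "\<not> k + 3 \<le> n1 + 3 * n2"
      have "k \<noteq> 0" using small n assms(2) True by auto
      have "k \<noteq> 1"
      proof
        assume "k = 1"
        then obtain v where v: "V 0 = {v}" by (auto simp: k_def card_1_singleton_iff)
        then have "nbhd T v \<inter> V 0 \<noteq> {}" using nbr0[of v] by simp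
        then have "(v, v) \<in> arcs_ends T" using v by (auto simp: nbhd_def)
        then show False using no_loops by (auto simp: arcs_ends_conv)
      qed
      have "m + 2 * b + 2 \<le> 2 * k + 2 * n1" "2 * k \<le> b" "n1 < k + 3"
        using small all ab e0 True by simp_all
      \<comment> \<open>The inequalities give \<open>3 * k + 2 \<le> 2 * n1 \<le> 2 * k + 4\<close>,
        so \<open>k \<le> 2\<close>; then \<open>k = 2\<close> forces \<open>n1 = 4\<close>.\<close>
      then have k: "k = 2" and n1: "n1 = 4"
        using \<open>k \<noteq> 0\<close> \<open>k \<noteq> 1\<close> m_ge by linarith+
      obtain u v where uv: "V 0 = {u, v}" "u \<noteq> v"
        using k by (auto simp: k_def card_2_iff)
      have irr: "(w, w) \<notin> arcs_ends T" for w using no_loops by (auto simp: arcs_ends_conv)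
      have "nbhd T u \<inter> V 0 \<noteq> {}" using nbr0[of u] uv by simp
      then have u_v: "(u, v) \<in> arcs_ends T" using uv irr by (auto simp: nbhd_def)
      have "2 \<le> card (nbhd T u \<inter> V 1)" "2 \<le> card (nbhd T v \<inter> V 1)"
        using dom[of u] dom[of v] uv V2 by auto
      then obtain A B where A: "A \<subseteq> nbhd T u \<inter> V 1" "card A = 2"
        and B: "B \<subseteq> nbhd T v \<inter> V 1" "card B = 2"
        by (meson obtain_subset_with_card_n)
      \<comment> \<open>A common neighbour \<open>x\<close> would close a triangle: six ordered
        pairs on three vertices, where sparsity permits four.\<close>
      have "A \<inter> B = {}"
      proof (rule ccontr)
        assume "A \<inter> B \<noteq> {}"
        then obtain x where x: "(u, x) \<in> arcs_ends T" "(v, x) \<in> arcs_ends T" "x \<in> V 1"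
          using A B by (auto simp: nbhd_def)
        have ne: "x \<noteq> u" "x \<noteq> v" using x irr by auto
        have "{(u, v), (v, u), (u, x), (x, u), (v, x), (x, v)} \<subseteq>
            arcs_ends T \<inter> {u, v, x} \<times> {u, v, x}"
          using x u_v arcs_ends_symmetric[OF sym_arcs] by auto
        from card_mono[OF _ this] have "6 \<le> card (arcs_ends T \<inter> {u, v, x} \<times> {u, v, x})"
          using ne uv by (simp add: card_insert_if)
        moreover have "{u, v, x} \<subseteq> verts T" using uv x Vv by blast
        ultimately show False using forest_sparse[OF T, of "{u, v, x}"] ne uv by simp
      qed
      moreover obtain a' b' c' d' where abcd: "A = {a', b'}" "a' \<noteq> b'" "B = {c', d'}" "c' \<noteq> d'"
        using A(2) B(2) by (auto simp: card_2_iff)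
      ultimately have "card (A \<union> B) = 4" by auto
      \<comment> \<open>The four chosen neighbours exhaust \<open>V 1\<close> because
        \<open>n1 = 4\<close>, so the tree has exactly six vertices.\<close>
      then have V1: "V 1 = A \<union> B"
        using card_seteq[OF fin, of "A \<union> B" 1] A B n1 by (simp add: n1_def)
      have dist: "distinct [u, v, a', b', c', d']"
        using abcd \<open>A \<inter> B = {}\<close> V1 uv dis[of 0 1] by auto
      have verts6: "verts T = {u, v, a', b', c', d'}"
        using verts V2 V1 uv abcd by auto
      have "digraph_iso T (double_star 2 2)"
        by (rule digraph_iso_double_star_2_2[OF T verts6 dist])
          (use A B abcd u_v in \<open>auto simp: nbhd_def\<close>)
      with assms(3) show False by contradiction
    qed
  qed
  then show ?thesis using w weight n by simp
qed

end
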